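(* Let $\mathcal H$ be a real Hilbert space and $\beta>0$. Let $f:\mathcal H\to\mathbb R$ be a convex function which is twice continuously differentiable, such that $\operatorname{argmin}_{\mathcal H}f\neq\emptyset$, and such that $\nabla f$ is Lipschitz continuous on the bounded subsets of $\mathcal H$. Let $\phi:\mathcal H\to\mathbb R_+$ be a damping potential such that, for some $r>0$, $\phi(u)\ge r\|u\|$ for all $u\in\mathcal H$. Let $x:[0,+\infty[\to\mathcal H$ be a solution trajectory of $$\ddot x(t)+\partial\phi\big(\dot x(t)+\beta\nabla f(x(t))\big)+\beta\nabla^2f(x(t))\dot x(t)+\nabla f(x(t))\ni0 .$$ Then after a finite time the trajectory follows the steepest descent dynamic, i.e. there exists $T\ge0$ such that $$\dot x(t)+\beta\nabla f(x(t))=0\quad\text{for all }t\ge T.$$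
   Context: A function $\phi:\mathcal H\to\mathbb R_+$ is a damping potential if: (i) $\phi$ is nonnegative, convex and continuous; (ii) $\phi(0)=0=\min_{\mathcal H}\phi$; (iii) for every $R>0$, $\sup_{\|u\|\le R}\|(\partial\phi)^0(u)\|<+\infty$, where $\partial\phi$ is the convex subdifferential and $(\partial\phi)^0(u)$ is the element of minimal norm of $\partial\phi(u)$. A solution trajectory (strong global solution) is a function $x\in\mathcal C^1([0,+\infty[;\mathcal H)$ such that, for all $T>0$, $\dot x$ is Lipschitz continuous on $(0,T)$ and $\ddot x\in L^\infty(0,T;\mathcal H)$, and the inclusion holds for almost every $t>0$. *)

theory Defs
  imports "HOL-Analysis.Analysis"
begin

definition subdifferential :: "('a::real_inner \<Rightarrow> real) \<Rightarrow> 'a \<Rightarrow> 'a set" where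
  "subdifferential \<phi> u = {p. \<forall>w. \<phi> w \<ge> \<phi> u + p \<bullet> (w - u)}"

(* For a continuous convex function on a Hilbert space the subdifferential is nonempty,
   closed and convex at every point, so there is exactly one minimiser of the norm. *)
definition minimal_subgradient :: "('a::real_inner \<Rightarrow> real) \<Rightarrow> 'a \<Rightarrow> 'a" where
  "minimal_subgradient \<phi> u = (ARG_MIN norm p. p \<in> subdifferential \<phi> u)"

definition damping_potential :: "('a::real_inner \<Rightarrow> real) \<Rightarrow> bool" where
  "damping_potential \<phi> \<longleftrightarrow>
     (\<forall>u. 0 \<le> \<phi> u) \<and> convex_on UNIV \<phi> \<and> continuous_on UNIV \<phi> \<and>
     \<phi> 0 = 0 \<and>
     (\<forall>R>0. bdd_above ((\<lambda>u. norm (minimal_subgradient \<phi> u)) ` cball 0 R))"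

(* Bochner measurability.  Plain Borel measurability would be too weak for values in a
   nonseparable space. *)
definition strongly_measurable :: "'b measure \<Rightarrow> ('b \<Rightarrow> 'a::real_normed_vector) \<Rightarrow> bool" where
  "strongly_measurable M g \<longleftrightarrow>
     (\<exists>s. (\<forall>i::nat. simple_function M (s i)) \<and> (AE t in M. (\<lambda>i. s i t) \<longlonglongrightarrow> g t))"

definition L_infinity :: "'b measure \<Rightarrow> ('b \<Rightarrow> 'a::real_normed_vector) \<Rightarrow> bool" where
  "L_infinity M g \<longleftrightarrow> strongly_measurable M g \<and> (\<exists>C. AE t in M. norm (g t) \<le> C)"

(* Here g and H stand for the gradient and the Hessian of f, and x' for the derivative of x
   (one-sided at 0).  The second derivative x'' is the almost everywhere derivative of x',
   which exists because a locally Lipschitz curve in a Hilbert space is differentiable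
   almost everywhere. *)
definition solution_trajectory ::
  "('a::real_inner \<Rightarrow> real) \<Rightarrow> real \<Rightarrow> ('a \<Rightarrow> 'a) \<Rightarrow> ('a \<Rightarrow> 'a \<Rightarrow>\<^sub>L 'a)
    \<Rightarrow> (real \<Rightarrow> 'a) \<Rightarrow> (real \<Rightarrow> 'a) \<Rightarrow> bool" where
  "solution_trajectory \<phi> \<beta> g H x x' \<longleftrightarrow>
     (\<forall>t\<ge>0. (x has_vector_derivative x' t) (at t within {0..})) \<and>
     continuous_on {0..} x' \<and>
     (\<forall>T>0. \<exists>L. L-lipschitz_on {0<..<T} x') \<and>
     (\<exists>x''.
        (AE t in lebesgue_on {0<..}. (x' has_vector_derivative x'' t) (at t)) \<and>
        (\<forall>T>0. L_infinity (lebesgue_on {0<..<T}) x'') \<and>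
        (AE t in lebesgue_on {0<..}.
           \<exists>p \<in> subdifferential \<phi> (x' t + \<beta> *\<^sub>R g (x t)).
             x'' t + p + \<beta> *\<^sub>R blinfun_apply (H (x t)) (x' t) + g (x t) = 0))"

end

theory Submission
  imports Defs
begin

text \<open>
  Put \<open>u = x' + \<beta> \<nabla>f(x)\<close>.  The inclusion is a first-order system in disguise: it says
  \<open>x' = u - \<beta> \<nabla>f(x)\<close> together with \<open>u' + \<partial>\<phi>(u) + \<nabla>f(x) \<ni> 0\<close>, so that \<open>u\<close> is subject to dry
  friction of strength at least \<open>r\<close>, because \<open>\<langle>p, u\<rangle> \<ge> \<phi>(u) \<ge> r |u|\<close> for \<open>p \<in> \<partial>\<phi>(u)\<close>.  Once the
  driving force \<open>\<nabla>f(x)\<close> stays below \<open>r / 2\<close>, friction decreases \<open>|u|\<close> at a rate of at least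
  \<open>r / 2\<close>, so \<open>u\<close> vanishes in finite time and never leaves 0 again
  (\<open>finite_time_extinction\<close>).  What remains is that \<open>\<nabla>f(x(t))\<close> tends to 0.

  The energy \<open>E = |u|\<^sup>2 / 2 + f(x)\<close> satisfies \<open>E' \<le> - r |u| - \<beta> |\<nabla>f(x)|\<^sup>2\<close> almost everywhere, and it
  is bounded below by the minimum \<open>f(z)\<close>.  The term \<open>r |u|\<close> bounds the trajectory: the gradient
  part of \<open>x'\<close> points towards \<open>z\<close> by convexity, so \<open>|x - z|\<close> grows at a rate of at most \<open>|u|\<close>, which
  the loss of energy pays for (\<open>bounded_x\<close>).  On the bounded range of \<open>x\<close> the gradient is
  Lipschitz, and \<open>x'\<close> is bounded, so \<open>\<nabla>f(x(t))\<close> is Lipschitz in \<open>t\<close>.  If it were not small at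
  some late time, it would stay large for a fixed length of time and cost a fixed amount of
  energy; a decreasing energy bounded below has no such amount left
  (\<open>gradient_eventually_small\<close>).

  All these estimates compare values of Lipschitz functions whose derivative is controlled only
  almost everywhere.  Stated as monotonicity, they need no integration theory:
  \<open>lipschitz_AE_deriv_nonpos_imp_le\<close> suffices.
\<close>

section \<open>Monotonicity from almost everywhere derivatives\<close>

text \<open>
  If \<open>h b > h a\<close>, the same holds for a slightly tilted function \<open>k\<close>, whose derivative is
  negative off \<open>N\<close>.  A Lipschitz function maps null sets to null sets, so some level \<open>c\<close> between
  \<open>k a\<close> and \<open>k b\<close> is not attained on \<open>N\<close>.  At the last time where \<open>k\<close> takes the value \<open>c\<close> the
  derivative exists and is negative, although \<open>k > c\<close> afterwards.
\<close>
lemma lipschitz_AE_deriv_nonpos_imp_le: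
  fixes h :: "real \<Rightarrow> real"
  assumes "a \<le> b" and lip: "L-lipschitz_on {a..b} h" and N: "negligible N"
    and deriv: "\<And>t. a < t \<Longrightarrow> t < b \<Longrightarrow> t \<notin> N \<Longrightarrow> \<exists>D\<le>0. (h has_real_derivative D) (at t)"
  shows "h b \<le> h a"
proof (rule ccontr)
  assume "\<not> h b \<le> h a"
  then have lt: "h a < h b" by simp
  with \<open>a \<le> b\<close> have ab: "a < b" by (metis less_eq_real_def less_irrefl)
  \<comment> \<open>This slope takes away half of the supposed increase of \<open>h\<close>.\<close>
  define e where "e = (h b - h a) / (2 * (b - a))"
  have e: "e > 0" using lt ab by (simp add: e_def)
  define k where "k = (\<lambda>t. h t - e * (t - a))"
  have "e * (b - a) = (h b - h a) / 2" using ab by (simp add: e_def field_simps)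
  then have kab: "k a < k b" using lt by (simp add: k_def)
  have "1-lipschitz_on {a..b} (\<lambda>t. t - a)" by (rule lipschitz_onI) (auto simp: dist_norm)
  from lipschitz_on_diff[OF lip lipschitz_on_cmult_real[OF this, of e]]
  have klip: "(L + \<bar>e\<bar> * 1)-lipschitz_on {a..b} k" unfolding k_def .
  then have kcont: "continuous_on {a..b} k" by (rule lipschitz_on_continuous_on)
  have "negligible (k ` (N \<inter> {a..b}))"
  proof (rule negligible_locally_Lipschitz_image)
    show "negligible (N \<inter> {a..b})" using N by (simp add: negligible_Int)
    fix s assume s: "s \<in> N \<inter> {a..b}"
    have "\<forall>y\<in>N \<inter> {a..b} \<inter> UNIV. norm (k y - k s) \<le> (L + \<bar>e\<bar> * 1) * norm (y - s)"
      using s lipschitz_on_normD[OF klip] by blast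
    then show "\<exists>T B. open T \<and> s \<in> T \<and> (\<forall>y\<in>N \<inter> {a..b} \<inter> T. norm (k y - k s) \<le> B * norm (y - s))"
      by blast
  qed simp
  moreover have "\<not> negligible {k a<..<k b}" using kab by (intro open_not_negligible) auto
  ultimately have "\<not> {k a<..<k b} \<subseteq> k ` (N \<inter> {a..b})"
    using negligible_subset by blast
  then obtain c where "c \<in> {k a<..<k b}" "c \<notin> k ` (N \<inter> {a..b})" by blast
  then have c: "k a < c" "c < k b" "c \<notin> k ` (N \<inter> {a..b})" by auto
  define S where "S = {t \<in> {a..b}. k t \<le> c}"
  define m where "m = Sup S"
  have aS: "a \<in> S" using c ab by (simp add: S_def)
  have bdd: "bdd_above S" unfolding S_def by (rule bdd_aboveI[of _ b]) simp
  have "closed S"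
    unfolding S_def using continuous_on_closed_Collect_le[OF kcont continuous_on_const closed_atLeastAtMost] .
  then have mS: "m \<in> S" unfolding m_def using closed_contains_Sup[of S] aS bdd by blast
  then have m: "a \<le> m" "m \<le> b" "k m \<le> c" by (auto simp: S_def)
  have above: "c < k s" if "m < s" "s \<le> b" for s
  proof (rule ccontr)
    assume "\<not> c < k s"
    then have "s \<in> S" using that m by (simp add: S_def)
    then have "s \<le> m" unfolding m_def using bdd by (rule cSup_upper)
    then show False using that by simp
  qed
  have "k m = c"
  proof -
    have "continuous_on {m..b} k" using kcont m by (rule_tac continuous_on_subset) auto
    then obtain s where "m \<le> s" "s \<le> b" "k s = c" using IVT'[of k m c b] m c by auto
    then show ?thesis using above[of s] by force
  qed
  then have "m \<notin> N" "a < m" "m < b" using c m by (auto simp: less_le)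
  then obtain D where D: "D \<le> 0" "(h has_real_derivative D) (at m)" using deriv by blast
  have "(k has_real_derivative (D - e)) (at m)"
    unfolding k_def by (rule derivative_eq_intros D refl | simp)+
  moreover have "D - e < 0" using D e by simp
  ultimately obtain d where d: "d > 0" "\<And>h. 0 < h \<Longrightarrow> h < d \<Longrightarrow> k (m + h) < k m"
    using DERIV_neg_dec_right by blast
  define \<eta> where "\<eta> = min (d/2) (b - m)"
  have "0 < \<eta>" "\<eta> < d" "m + \<eta> \<le> b" using d \<open>m < b\<close> by (auto simp: \<eta>_def)
  then show False using d(2)[of \<eta>] above[of "m + \<eta>"] \<open>k m = c\<close> by force
qed

section \<open>Convexity and Lipschitz estimates\<close>

lemma convex_on_gradient_inequality:
  fixes f :: "'a::real_inner \<Rightarrow> real"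
  assumes "convex_on UNIV f" and "GDERIV f w :> g"
  shows "f w + g \<bullet> (z - w) \<le> f z"
proof -
  define p where "p = (\<lambda>s. f (w + s *\<^sub>R (z - w)))"
  have "convex_on UNIV p"
  proof (rule convex_onI)
    fix t s s' :: real assume "0 < t" "t < 1"
    have "w + ((1 - t) *\<^sub>R s + t *\<^sub>R s') *\<^sub>R (z - w)
       = (1 - t) *\<^sub>R (w + s *\<^sub>R (z - w)) + t *\<^sub>R (w + s' *\<^sub>R (z - w))"
      by (simp add: algebra_simps)
    then show "p ((1 - t) *\<^sub>R s + t *\<^sub>R s') \<le> (1 - t) * p s + t * p s'"
      unfolding p_def using convex_onD[OF assms(1), of t] \<open>0 < t\<close> \<open>t < 1\<close> by simp
  qed simp
  moreover have "(p has_real_derivative (g \<bullet> (z - w))) (at 0 within UNIV)"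
  proof -
    have "((\<lambda>s. w + s *\<^sub>R (z - w)) has_derivative (\<lambda>s. s *\<^sub>R (z - w))) (at 0)"
      by (auto intro!: derivative_eq_intros)
    moreover have "(f has_derivative (\<lambda>h. h \<bullet> g)) (at (w + 0 *\<^sub>R (z - w)))"
      using assms(2) by (simp add: gderiv_def)
    ultimately have "(p has_derivative (\<lambda>s. (s *\<^sub>R (z - w)) \<bullet> g)) (at 0)"
      unfolding p_def by (rule has_derivative_compose)
    then show ?thesis
      by (simp add: has_field_derivative_def inner_commute mult_commute_abs)
  qed
  ultimately have "p 1 - p 0 \<ge> g \<bullet> (z - w) * (1 - 0)"
    by (intro convex_on_imp_above_tangent[where A = UNIV]) auto
  then show ?thesis by (simp add: p_def)
qed

lemma lipschitz_on_bounded_image: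
  assumes "L-lipschitz_on X h" and "bounded X"
  shows "bounded (h ` X)"
proof (cases "X = {}")
  case False
  then obtain a where a: "a \<in> X" by blast
  obtain e where e: "\<And>y. y \<in> X \<Longrightarrow> dist a y \<le> e"
    using assms(2) bounded_any_center[of X a] by blast
  have "dist (h a) (h y) \<le> L * e" if "y \<in> X" for y
    using lipschitz_onD[OF assms(1) a that]
      mult_left_mono[OF e[OF that] lipschitz_on_nonneg[OF assms(1)]] by linarith
  then show ?thesis unfolding bounded_def by blast
qed simp

lemma C1_imp_lipschitz_on_interval:
  fixes c :: "real \<Rightarrow> 'a::real_normed_vector"
  assumes "\<And>t. t \<in> {a..b} \<Longrightarrow> (c has_vector_derivative c' t) (at t)"
    and "continuous_on {a..b} c'"
  shows "\<exists>L. L-lipschitz_on {a..b} c"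
proof -
  have "bounded (c' ` {a..b})"
    using assms(2) by (intro compact_imp_bounded compact_continuous_image) auto
  then obtain B where B: "B > 0" "\<And>t. t \<in> {a..b} \<Longrightarrow> norm (c' t) \<le> B"
    by (auto simp: bounded_pos)
  have "B-lipschitz_on {a..b} c"
  proof (rule bounded_derivative_imp_lipschitz)
    show "(c has_derivative (\<lambda>s. s *\<^sub>R c' t)) (at t within {a..b})" if "t \<in> {a..b}" for t
      using assms(1)[OF that] has_derivative_at_withinI unfolding has_vector_derivative_def by blast
    show "onorm (\<lambda>s. s *\<^sub>R c' t) \<le> B" if "t \<in> {a..b}" for t
      using B(2)[OF that] by (intro onorm_le) (simp add: mult.commute[of B] mult_left_mono)
  qed (use B in auto)
  then show ?thesis by blast
qed

lemma lipschitz_on_inner_self: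
  fixes u :: "'b::metric_space \<Rightarrow> 'a::real_inner"
  assumes "L-lipschitz_on X u" and "\<And>t. t \<in> X \<Longrightarrow> norm (u t) \<le> B" and "0 \<le> B"
  shows "(2 * B * L)-lipschitz_on X (\<lambda>t. u t \<bullet> u t)"
proof (rule lipschitz_onI)
  fix s t assume st: "s \<in> X" "t \<in> X"
  have "dist (u s \<bullet> u s) (u t \<bullet> u t) = \<bar>(u s + u t) \<bullet> (u s - u t)\<bar>"
    by (simp add: dist_norm algebra_simps inner_commute)
  also have "\<dots> \<le> norm (u s + u t) * norm (u s - u t)" by (rule Cauchy_Schwarz_ineq2)
  also have "\<dots> \<le> (2 * B) * (L * dist s t)"
    using assms(2)[OF st(1)] assms(2)[OF st(2)] norm_triangle_ineq[of "u s" "u t"]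
      lipschitz_onD[OF assms(1) st] assms(3)
    by (intro mult_mono) (auto simp: dist_norm)
  finally show "dist (u s \<bullet> u s) (u t \<bullet> u t) \<le> 2 * B * L * dist s t" by (simp add: mult.assoc)
qed (use assms lipschitz_on_nonneg[OF assms(1)] in simp)

section \<open>Gradient flows perturbed by a force with dry friction\<close>

text \<open>
  The pair \<open>(x, u)\<close> solves \<open>x' = u - \<beta> g(x)\<close> and, off the null set \<open>N\<close>, an equation for \<open>u'\<close> of
  which only the inner product with \<open>u\<close> matters; this keeps \<open>\<phi>\<close> and the Hessian of \<open>f\<close> out of the
  asymptotic analysis.  The start time \<open>t0\<close> is a parameter so that two-sided derivatives can be
  required at every time considered.
\<close>
locale damped_gradient_flow =
  fixes f :: "'a::real_inner \<Rightarrow> real" and g :: "'a \<Rightarrow> 'a" and z :: 'a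
    and \<beta> r t0 :: real and x u :: "real \<Rightarrow> 'a" and N :: "real set"
  assumes \<beta>: "\<beta> > 0" and r: "r > 0"
    and convex: "convex_on UNIV f"
    and grad: "\<And>w. GDERIV f w :> g w"
    and min: "\<And>w. f z \<le> f w"
    and g_lip: "\<And>B. bounded B \<Longrightarrow> \<exists>L. L-lipschitz_on B g"
    and N: "negligible N"
    and x_deriv: "\<And>t. t0 \<le> t \<Longrightarrow> (x has_vector_derivative u t - \<beta> *\<^sub>R g (x t)) (at t)"
    and u_lip: "\<And>T. \<exists>L. L-lipschitz_on {t0..T} u"
    and u_deriv: "\<And>t. t0 < t \<Longrightarrow> t \<notin> N \<Longrightarrow>
      \<exists>u'. (u has_vector_derivative u') (at t) \<and> u' \<bullet> u t + g (x t) \<bullet> u t \<le> - r * norm (u t)"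
begin

definition energy :: "real \<Rightarrow> real" where
  "energy t = u t \<bullet> u t / 2 + f (x t)"

lemma u_lip_interval: "t0 \<le> a \<Longrightarrow> \<exists>L. L-lipschitz_on {a..b} u"
  using u_lip[of b] lipschitz_on_subset[of _ "{t0..b}" u "{a..b}"] by fastforce

lemma continuous_on_u: "t0 \<le> a \<Longrightarrow> continuous_on {a..b} u"
  using u_lip_interval lipschitz_on_continuous_on by blast

lemma continuous_on_x: "t0 \<le> a \<Longrightarrow> continuous_on {a..b} x"
  by (intro continuous_at_imp_continuous_on ballI has_vector_derivative_continuous[OF x_deriv]) auto

lemma continuous_on_g_x:
  assumes "t0 \<le> a" shows "continuous_on {a..b} (\<lambda>t. g (x t))"
proof -
  have "bounded (x ` {a..b})"
    using continuous_on_x[OF assms] by (intro compact_imp_bounded compact_continuous_image) auto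
  then have "continuous_on (x ` {a..b}) g" using g_lip lipschitz_on_continuous_on by blast
  then show ?thesis using continuous_on_compose2[OF _ continuous_on_x[OF assms]] by blast
qed

lemma f_x_deriv:
  assumes "t0 \<le> t"
  shows "((\<lambda>t. f (x t)) has_real_derivative g (x t) \<bullet> u t - \<beta> * (norm (g (x t)))\<^sup>2) (at t)"
proof -
  have "(f has_derivative (\<lambda>h. h \<bullet> g (x t))) (at (x t))"
    using grad by (simp add: gderiv_def)
  from has_derivative_compose[OF x_deriv[OF assms, unfolded has_vector_derivative_def] this]
  show ?thesis
    by (rule has_derivative_imp_has_field_derivative)
      (simp add: inner_diff_left inner_commute[of "u t"] power2_norm_eq_inner)
qed

text \<open>
  The power inequality for \<open>u\<close> gives \<open>(|u|\<^sup>2 / 2)' \<le> - r |u| - \<langle>g(x), u\<rangle>\<close> almost everywhere.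
  A function \<open>q\<close> may therefore be added without destroying monotonicity as long as \<open>q'\<close> is at most
  the dissipated power.  Different choices of \<open>q\<close> yield energy decay, boundedness of \<open>x\<close> and the
  invariance of \<open>u = 0\<close>.
\<close>
lemma kinetic_plus_potential_le:
  assumes ab: "t0 \<le> a" "a \<le> b"
    and q: "\<And>t. t \<in> {a..b} \<Longrightarrow> (q has_real_derivative q' t) (at t)" "continuous_on {a..b} q'"
    and le: "\<And>t. a < t \<Longrightarrow> t < b \<Longrightarrow> q' t \<le> r * norm (u t) + g (x t) \<bullet> u t"
  shows "u b \<bullet> u b / 2 + q b \<le> u a \<bullet> u a / 2 + q a"
proof -
  obtain L where L: "L-lipschitz_on {a..b} u" using u_lip_interval[OF ab(1)] by blast
  have "bounded (u ` {a..b})"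
    using continuous_on_u[OF ab(1)] by (intro compact_imp_bounded compact_continuous_image) auto
  then obtain B where "B > 0" "\<And>t. t \<in> {a..b} \<Longrightarrow> norm (u t) \<le> B"
    by (auto simp: bounded_pos)
  then have "(2 * B * L)-lipschitz_on {a..b} (\<lambda>t. u t \<bullet> u t)"
    using lipschitz_on_inner_self[OF L] by simp
  from lipschitz_on_cmult_real[OF this, of "1/2"]
  have "(\<bar>1/2\<bar> * (2 * B * L))-lipschitz_on {a..b} (\<lambda>t. u t \<bullet> u t / 2)" by simp
  moreover have "(q has_vector_derivative q' t) (at t)" if "t \<in> {a..b}" for t
    using q(1)[OF that] by (simp add: has_real_derivative_iff_has_vector_derivative)
  then obtain M where "M-lipschitz_on {a..b} q"
    using C1_imp_lipschitz_on_interval[of a b q q'] q(2) by blast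
  ultimately have "(\<bar>1/2\<bar> * (2 * B * L) + M)-lipschitz_on {a..b} (\<lambda>t. u t \<bullet> u t / 2 + q t)"
    by (rule lipschitz_on_add)
  then show ?thesis
  proof (rule lipschitz_AE_deriv_nonpos_imp_le[OF ab(2) _ N])
    fix t assume t: "a < t" "t < b" "t \<notin> N"
    then obtain u' where u': "(u has_vector_derivative u') (at t)"
      "u' \<bullet> u t + g (x t) \<bullet> u t \<le> - r * norm (u t)" using u_deriv ab by force
    have "((\<lambda>t. u t \<bullet> u t) has_derivative (\<lambda>s. u t \<bullet> (s *\<^sub>R u') + (s *\<^sub>R u') \<bullet> u t)) (at t)"
      by (intro has_derivative_inner u'(1)[unfolded has_vector_derivative_def])
    then have "((\<lambda>t. u t \<bullet> u t) has_real_derivative 2 * (u' \<bullet> u t)) (at t)"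
      by (rule has_derivative_imp_has_field_derivative) (simp add: inner_commute)
    from DERIV_add[OF DERIV_cdivide[OF this, of 2] q(1)[of t]] t
    have "((\<lambda>t. u t \<bullet> u t / 2 + q t) has_real_derivative u' \<bullet> u t + q' t) (at t)" by simp
    moreover have "u' \<bullet> u t + q' t \<le> 0" using u'(2) le[OF t(1,2)] by simp
    ultimately show "\<exists>D\<le>0. ((\<lambda>t. u t \<bullet> u t / 2 + q t) has_real_derivative D) (at t)" by blast
  qed
qed

text \<open>
  Here \<open>c\<close> is a lower bound for the power dissipated by the gradient alone; the friction is
  dropped.  The linear term \<open>c t\<close> in \<open>q\<close> takes the place of an integral of that power.
\<close>
lemma energy_drop:
  assumes ab: "t0 \<le> a" "a \<le> b"
    and c: "\<And>t. a < t \<Longrightarrow> t < b \<Longrightarrow> c \<le> \<beta> * (norm (g (x t)))\<^sup>2"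
  shows "energy b + c * (b - a) \<le> energy a"
proof -
  have "u b \<bullet> u b / 2 + (f (x b) + c * b) \<le> u a \<bullet> u a / 2 + (f (x a) + c * a)"
  proof (rule kinetic_plus_potential_le[OF ab, where q = "\<lambda>t. f (x t) + c * t"
        and q' = "\<lambda>t. g (x t) \<bullet> u t - \<beta> * (norm (g (x t)))\<^sup>2 + c"])
    show "((\<lambda>t. f (x t) + c * t) has_real_derivative
        g (x t) \<bullet> u t - \<beta> * (norm (g (x t)))\<^sup>2 + c) (at t)" if "t \<in> {a..b}" for t
      using that ab DERIV_add[OF f_x_deriv DERIV_cmult_Id, of t c] by simp
    show "continuous_on {a..b} (\<lambda>t. g (x t) \<bullet> u t - \<beta> * (norm (g (x t)))\<^sup>2 + c)"
      using continuous_on_u[OF ab(1)] continuous_on_g_x[OF ab(1)] by (intro continuous_intros)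
    show "g (x t) \<bullet> u t - \<beta> * (norm (g (x t)))\<^sup>2 + c \<le> r * norm (u t) + g (x t) \<bullet> u t"
      if "a < t" "t < b" for t
    proof -
      have "0 \<le> r * norm (u t)" using r by simp
      then show ?thesis using c[OF that] by linarith
    qed
  qed
  then show ?thesis unfolding energy_def right_diff_distrib by linarith
qed

lemma energy_antimono: "t0 \<le> a \<Longrightarrow> a \<le> b \<Longrightarrow> energy b \<le> energy a"
  using energy_drop[of a b 0] \<beta> by simp

lemma min_le_energy: "f z \<le> energy t"
  using min[of "x t"] inner_ge_zero[of "u t"] by (simp add: energy_def add_increasing)

text \<open>
  The function \<open>r |x - z| + E\<close> would be decreasing, but the norm is not differentiable where
  \<open>x = z\<close>.  Its smooth substitute \<open>\<rho>\<close> dominates \<open>|x - z|\<close> and still satisfies \<open>\<rho>' \<le> |u|\<close>.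
\<close>
lemma bounded_x: "bounded (x ` {t0..})"
proof -
  define \<rho> where "\<rho> t = sqrt (1 + (x t - z) \<bullet> (x t - z))" for t
  have pos: "0 < 1 + (x t - z) \<bullet> (x t - z)" for t
    using inner_ge_zero[of "x t - z"] by linarith
  have \<rho>_pos: "0 < \<rho> t" for t using pos by (simp add: \<rho>_def)
  have \<rho>_ge: "norm (x t - z) \<le> \<rho> t" for t
    by (simp add: \<rho>_def norm_eq_sqrt_inner)
  define \<rho>' where "\<rho>' t = (x t - z) \<bullet> (u t - \<beta> *\<^sub>R g (x t)) / \<rho> t" for t
  have \<rho>_deriv: "(\<rho> has_real_derivative \<rho>' t) (at t)" if "t0 \<le> t" for t
  proof -
    note x_deriv[OF that, unfolded has_vector_derivative_def, derivative_intros]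
    have "((\<lambda>t. 1 + (x t - z) \<bullet> (x t - z)) has_derivative
       (\<lambda>s. s * (2 * ((x t - z) \<bullet> (u t - \<beta> *\<^sub>R g (x t)))))) (at t)"
      by (rule derivative_eq_intros refl | simp add: inner_commute algebra_simps)+
    then have "((\<lambda>t. 1 + (x t - z) \<bullet> (x t - z)) has_real_derivative
       2 * ((x t - z) \<bullet> (u t - \<beta> *\<^sub>R g (x t)))) (at t)"
      by (rule has_derivative_imp_has_field_derivative) simp
    from DERIV_chain2[OF DERIV_real_sqrt[OF pos] this]
    show ?thesis unfolding \<rho>_def \<rho>'_def by (simp add: field_simps)
  qed
  have \<rho>'_le: "\<rho>' t \<le> norm (u t)" for t
  proof -
    \<comment> \<open>Convexity and minimality of \<open>z\<close>: the descent direction does not increase the distance to \<open>z\<close>.\<close>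
    have "f (x t) + g (x t) \<bullet> (z - x t) \<le> f z"
      by (rule convex_on_gradient_inequality[OF convex grad])
    then have "0 \<le> (x t - z) \<bullet> g (x t)" using min[of "x t"]
      by (simp add: inner_diff_left inner_diff_right inner_commute)
    then have "(x t - z) \<bullet> (u t - \<beta> *\<^sub>R g (x t)) \<le> (x t - z) \<bullet> u t"
      using \<beta> by (simp add: inner_diff_right)
    also have "\<dots> \<le> norm (x t - z) * norm (u t)" by (rule norm_cauchy_schwarz)
    also have "\<dots> \<le> \<rho> t * norm (u t)" by (intro mult_right_mono \<rho>_ge) simp
    finally show ?thesis using \<rho>_pos[of t] by (simp add: \<rho>'_def field_simps)
  qed
  have "norm (x t - z) \<le> \<rho> t0 + (energy t0 - f z) / r" if t: "t0 \<le> t" for t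
  proof -
    have "u t \<bullet> u t / 2 + (r * \<rho> t + f (x t)) \<le> u t0 \<bullet> u t0 / 2 + (r * \<rho> t0 + f (x t0))"
    proof (rule kinetic_plus_potential_le[OF order_refl t, where q = "\<lambda>t. r * \<rho> t + f (x t)"
          and q' = "\<lambda>s. r * \<rho>' s + (g (x s) \<bullet> u s - \<beta> * (norm (g (x s)))\<^sup>2)"])
      show "((\<lambda>t. r * \<rho> t + f (x t)) has_real_derivative
          r * \<rho>' s + (g (x s) \<bullet> u s - \<beta> * (norm (g (x s)))\<^sup>2)) (at s)" if "s \<in> {t0..t}" for s
        using that by (auto intro!: DERIV_add[OF DERIV_cmult[OF \<rho>_deriv] f_x_deriv])
      show "continuous_on {t0..t} (\<lambda>s. r * \<rho>' s + (g (x s) \<bullet> u s - \<beta> * (norm (g (x s)))\<^sup>2))"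
        using \<rho>_pos continuous_on_u[OF order_refl] continuous_on_g_x[OF order_refl]
          continuous_on_x[OF order_refl] unfolding \<rho>'_def \<rho>_def
        by (intro continuous_intros ballI) (auto simp: less_imp_neq[symmetric])
      show "r * \<rho>' s + (g (x s) \<bullet> u s - \<beta> * (norm (g (x s)))\<^sup>2) \<le> r * norm (u s) + g (x s) \<bullet> u s" for s
      proof -
        have "r * \<rho>' s \<le> r * norm (u s)" using \<rho>'_le[of s] r by (intro mult_left_mono) auto
        moreover have "0 \<le> \<beta> * (norm (g (x s)))\<^sup>2" using \<beta> by simp
        ultimately show ?thesis by linarith
      qed
    qed
    then have "r * \<rho> t \<le> r * \<rho> t0 + (energy t0 - f z)"
      using min_le_energy[of t] by (simp add: energy_def)
    then have "\<rho> t \<le> \<rho> t0 + (energy t0 - f z) / r" using r by (simp add: field_simps)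
    then show ?thesis using \<rho>_ge[of t] by linarith
  qed
  then show ?thesis
    by (intro bounded_subset[OF bounded_cball[of z]]) (auto simp: dist_norm norm_minus_commute)
qed

text \<open>
  The velocity \<open>u - \<beta> g(x)\<close> is bounded: \<open>|u|\<close> by the initial energy, and \<open>g(x)\<close> because \<open>x\<close> stays
  in a bounded set.
\<close>
lemma lipschitz_g_x: "\<exists>K>0. K-lipschitz_on {t0..} (\<lambda>t. g (x t))"
proof -
  obtain L where Lx: "L-lipschitz_on (x ` {t0..}) g" using g_lip bounded_x by blast
  have "bounded (g ` x ` {t0..})" by (rule lipschitz_on_bounded_image[OF Lx bounded_x])
  then obtain G where G: "\<And>t. t0 \<le> t \<Longrightarrow> norm (g (x t)) \<le> G" by (auto simp: bounded_iff)
  define U where "U = sqrt (2 * (energy t0 - f z))"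
  have U: "norm (u t) \<le> U" if "t0 \<le> t" for t
    using energy_antimono[OF order_refl that] min[of "x t"]
    unfolding U_def norm_eq_sqrt_inner energy_def by (intro real_sqrt_le_mono) simp
  have "(U + \<beta> * G)-lipschitz_on {t0..} x"
  proof (rule bounded_derivative_imp_lipschitz)
    show "(x has_derivative (\<lambda>s. s *\<^sub>R (u t - \<beta> *\<^sub>R g (x t)))) (at t within {t0..})"
      if "t \<in> {t0..}" for t
      using x_deriv[of t] that has_derivative_at_withinI unfolding has_vector_derivative_def by auto
    have bd: "norm (u t - \<beta> *\<^sub>R g (x t)) \<le> U + \<beta> * G" if "t \<in> {t0..}" for t
    proof -
      have "norm (\<beta> *\<^sub>R g (x t)) \<le> \<beta> * G" using G[of t] that \<beta> by simp
      then show ?thesis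
        using norm_triangle_ineq4[of "u t" "\<beta> *\<^sub>R g (x t)"] U[of t] that by auto
    qed
    show "onorm (\<lambda>s. s *\<^sub>R (u t - \<beta> *\<^sub>R g (x t))) \<le> U + \<beta> * G" if "t \<in> {t0..}" for t
      using bd[OF that] by (intro onorm_le) (simp add: mult.commute[of "U + \<beta> * G"] mult_left_mono)
    show "0 \<le> U + \<beta> * G" using order_trans[OF norm_ge_zero bd[of t0]] by simp
  qed simp
  from lipschitz_on_compose2[OF this Lx]
  have "(L * (U + \<beta> * G) + 1)-lipschitz_on {t0..} (\<lambda>t. g (x t))" by (rule lipschitz_on_le) simp
  moreover have "0 < L * (U + \<beta> * G) + 1"
    using lipschitz_on_nonneg[OF lipschitz_on_compose2[OF \<open>(U + \<beta> * G)-lipschitz_on {t0..} x\<close> Lx]] by simp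
  ultimately show ?thesis by blast
qed

text \<open>
  With Lipschitz constant \<open>K\<close>, a value of \<open>|g(x)|\<close> above \<open>\<delta>\<close> keeps it above \<open>\<delta> / 2\<close> for a time
  \<open>l = \<delta> / (2 K)\<close>, which costs the energy \<open>c l\<close> with \<open>c = \<beta> (\<delta> / 2)\<^sup>2\<close>.  This cannot happen once the
  energy is within \<open>c l\<close> of its infimum.
\<close>
lemma gradient_eventually_small:
  assumes "\<delta> > 0"
  shows "\<exists>T\<ge>t0. \<forall>t\<ge>T. norm (g (x t)) \<le> \<delta>"
proof -
  obtain K where K: "K > 0" "K-lipschitz_on {t0..} (\<lambda>t. g (x t))" using lipschitz_g_x by blast
  define l where "l = \<delta> / (2 * K)"
  define c where "c = \<beta> * (\<delta> / 2)\<^sup>2"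
  have lc: "l > 0" "c > 0" using assms K(1) \<beta> by (simp_all add: l_def c_def)
  define m where "m = Inf (energy ` {t0..})"
  have bdd: "bdd_below (energy ` {t0..})" using min_le_energy by (auto intro!: bdd_belowI)
  obtain T where T: "t0 \<le> T" "energy T < m + c * l"
    using cInf_lessD[of "energy ` {t0..}" "m + c * l"] lc unfolding m_def by auto
  have "norm (g (x t)) \<le> \<delta>" if t: "T \<le> t" for t
  proof (rule ccontr)
    assume big: "\<not> norm (g (x t)) \<le> \<delta>"
    have "c \<le> \<beta> * (norm (g (x s)))\<^sup>2" if s: "t < s" "s < t + l" for s
    proof -
      have "norm (g (x t) - g (x s)) \<le> K * norm (t - s)"
        using lipschitz_on_normD[OF K(2), of t s] s t T by simp
      also have "\<dots> \<le> K * l" using s K(1) by simp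
      also have "\<dots> = \<delta> / 2" using K(1) by (simp add: l_def)
      finally have "\<delta> / 2 \<le> norm (g (x s))"
        using norm_triangle_sub[of "g (x t)" "g (x s)"] big by linarith
      then show ?thesis using \<beta> assms unfolding c_def by (intro mult_left_mono power_mono) auto
    qed
    then have "energy (t + l) + c * l \<le> energy t" using energy_drop[of t "t + l" c] t T lc by simp
    moreover have "energy t \<le> energy T" using energy_antimono T t by simp
    moreover have "m \<le> energy (t + l)"
      unfolding m_def using T t lc by (intro cInf_lower bdd) auto
    ultimately show False using T by simp
  qed
  then show ?thesis using T by blast
qed

text \<open>
  While \<open>u\<close> does not vanish, its norm is differentiable wherever \<open>u\<close> is, with derivative at most
  \<open>- r / 2\<close> after the gradient has become small; a nonnegative function cannot keep this up.
  From a zero of \<open>u\<close> onwards, \<open>|u|\<^sup>2\<close> is nonincreasing.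
\<close>
lemma finite_time_extinction: "\<exists>T\<ge>t0. \<forall>t\<ge>T. u t = 0"
proof -
  obtain T where T: "t0 \<le> T" and g_small: "\<And>t. T \<le> t \<Longrightarrow> norm (g (x t)) \<le> r / 2"
    using gradient_eventually_small[of "r / 2"] r by auto
  have work: "- (r / 2) * norm (u t) \<le> g (x t) \<bullet> u t" if "T \<le> t" for t
    using Cauchy_Schwarz_ineq2[of "g (x t)" "u t"] mult_right_mono[OF g_small[OF that], of "norm (u t)"]
    by (simp add: abs_le_iff)
  have "\<exists>S\<ge>T. u S = 0"
  proof (rule ccontr)
    assume "\<not> (\<exists>S\<ge>T. u S = 0)"
    then have nz: "u t \<noteq> 0" if "T \<le> t" for t using that by blast
    \<comment> \<open>By this time the norm would have dropped to at most \<open>-1\<close>.\<close>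
    define S where "S = T + 2 * (norm (u T) + 1) / r"
    have S: "T \<le> S" "r / 2 * (S - T) = norm (u T) + 1" using r by (simp_all add: S_def)
    obtain L where L: "L-lipschitz_on {T..S} u" using u_lip_interval[OF T] by blast
    have "1-lipschitz_on (u ` {T..S}) norm"
      by (rule lipschitz_onI) (auto simp: dist_norm norm_triangle_ineq3)
    from lipschitz_on_compose2[OF L this]
    have "(1 * L)-lipschitz_on {T..S} (\<lambda>t. norm (u t))" .
    from lipschitz_on_add[OF this lipschitz_on_cmult_real[OF lipschitz_on_id, of "r / 2"]]
    have "norm (u S) + r / 2 * S \<le> norm (u T) + r / 2 * T"
    proof (rule lipschitz_AE_deriv_nonpos_imp_le[OF S(1) _ N])
      fix t assume t: "T < t" "t < S" "t \<notin> N"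
      then obtain u' where u': "(u has_vector_derivative u') (at t)"
        "u' \<bullet> u t + g (x t) \<bullet> u t \<le> - r * norm (u t)" using u_deriv T by force
      have "(norm has_derivative (\<lambda>h. h \<bullet> sgn (u t))) (at (u t))"
        using GDERIV_norm[of "u t"] nz[of t] t by (simp add: gderiv_def)
      from has_derivative_compose[OF u'(1)[unfolded has_vector_derivative_def] this]
      have "((\<lambda>t. norm (u t)) has_real_derivative u' \<bullet> sgn (u t)) (at t)"
        by (rule has_derivative_imp_has_field_derivative) simp
      then have "((\<lambda>t. norm (u t) + r / 2 * t) has_real_derivative u' \<bullet> sgn (u t) + r / 2) (at t)"
        by (intro DERIV_add DERIV_cmult_Id)
      moreover have "u' \<bullet> sgn (u t) + r / 2 \<le> 0"
      proof -
        have "u' \<bullet> u t \<le> - (r / 2) * norm (u t)" using u'(2) work[of t] t by simp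
        then show ?thesis using nz[of t] t by (simp add: sgn_div_norm field_simps)
      qed
      ultimately show "\<exists>D\<le>0. ((\<lambda>t. norm (u t) + r / 2 * t) has_real_derivative D) (at t)" by blast
    qed
    then show False using S(2) norm_ge_zero[of "u S"] by (simp add: algebra_simps)
  qed
  then obtain S where S: "T \<le> S" "u S = 0" by blast
  have "u t = 0" if t: "S \<le> t" for t
  proof -
    have "u t \<bullet> u t / 2 + 0 \<le> u S \<bullet> u S / 2 + (0::real)"
    proof (rule kinetic_plus_potential_le[where q = "\<lambda>_. 0" and q' = "\<lambda>_. 0"])
      show "0 \<le> r * norm (u s) + g (x s) \<bullet> u s" if "S < s" for s
      proof -
        have "0 \<le> r / 2 * norm (u s)" using r by simp
        then show ?thesis using work[of s] S that by (simp add: algebra_simps)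
      qed
    qed (use S T t in auto)
    then show ?thesis using S inner_ge_zero[of "u t"] by simp
  qed
  then show ?thesis using S T by (intro exI[of _ S]) auto
qed

end

section \<open>Trajectories of the differential inclusion\<close>

lemma subgradient_inner_ge:
  assumes "p \<in> subdifferential \<phi> v" and "\<phi> 0 = 0"
  shows "\<phi> v \<le> p \<bullet> v"
proof -
  have "\<phi> v + p \<bullet> (0 - v) \<le> \<phi> 0" using assms(1) unfolding subdifferential_def by blast
  then show ?thesis using assms(2) by simp
qed

theorem proposition10p5:
  fixes f :: "'a::{real_inner, complete_space} \<Rightarrow> real"
    and gradf :: "'a \<Rightarrow> 'a"
    and hessf :: "'a \<Rightarrow> 'a \<Rightarrow>\<^sub>L 'a"
    and \<phi> :: "'a \<Rightarrow> real"
    and \<beta> r :: real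
    and x x' :: "real \<Rightarrow> 'a"
  assumes "\<beta> > 0"
    and "convex_on UNIV f"
    and "\<And>u. GDERIV f u :> gradf u"
    and "\<And>u. (gradf has_derivative blinfun_apply (hessf u)) (at u)"
    and "continuous_on UNIV hessf"
    and "{z. \<forall>u. f z \<le> f u} \<noteq> {}"
    and "\<And>B. bounded B \<Longrightarrow> \<exists>L. L-lipschitz_on B gradf"
    and "damping_potential \<phi>"
    and "r > 0"
    and "\<And>u. \<phi> u \<ge> r * norm u"
    and "solution_trajectory \<phi> \<beta> gradf hessf x x'"
  shows "\<exists>T\<ge>0. \<forall>t\<ge>T. x' t + \<beta> *\<^sub>R gradf (x t) = 0"
proof -
  from assms(11) obtain x'' where
    x_deriv_within: "\<And>t. 0 \<le> t \<Longrightarrow> (x has_vector_derivative x' t) (at t within {0..})"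
    and x'_lip: "\<And>T. 0 < T \<Longrightarrow> \<exists>L. L-lipschitz_on {0<..<T} x'"
    and x''_AE: "AE t in lebesgue_on {0<..}. (x' has_vector_derivative x'' t) (at t)"
    and incl_AE: "AE t in lebesgue_on {0<..}. \<exists>p \<in> subdifferential \<phi> (x' t + \<beta> *\<^sub>R gradf (x t)).
             x'' t + p + \<beta> *\<^sub>R blinfun_apply (hessf (x t)) (x' t) + gradf (x t) = 0"
    unfolding solution_trajectory_def by blast
  have x_deriv: "(x has_vector_derivative x' t) (at t)" if "0 < t" for t
    using x_deriv_within[of t] that at_within_interior[of t "{0..}"]
    by (simp add: interior_real_atLeast)
  define P where "P t \<longleftrightarrow> (x' has_vector_derivative x'' t) (at t) \<and>
     (\<exists>p \<in> subdifferential \<phi> (x' t + \<beta> *\<^sub>R gradf (x t)).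
             x'' t + p + \<beta> *\<^sub>R blinfun_apply (hessf (x t)) (x' t) + gradf (x t) = 0)" for t
  have "AE t in lebesgue_on {0<..}. P t" using x''_AE incl_AE unfolding P_def by eventually_elim simp
  then have "AE t in lebesgue. t \<in> {0<..} \<longrightarrow> P t"
    by (subst (asm) AE_restrict_space_iff) auto
  then obtain N where N: "negligible N" and NP: "\<And>t. 0 < t \<Longrightarrow> t \<notin> N \<Longrightarrow> P t"
    unfolding eventually_ae_filter_negligible by force
  obtain z where z: "\<And>w. f z \<le> f w" using assms(6) by blast
  define u where "u t = x' t + \<beta> *\<^sub>R gradf (x t)" for t
  \<comment> \<open>Any positive start time would do; at time 0 the derivative of \<open>x\<close> is one-sided.\<close>
  interpret damped_gradient_flow f gradf z \<beta> r 1 x u N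
  proof
    show "(x has_vector_derivative u t - \<beta> *\<^sub>R gradf (x t)) (at t)" if "1 \<le> t" for t
      using x_deriv[of t] that by (simp add: u_def)
  next
    fix T :: real
    obtain L where L: "L-lipschitz_on {0<..<\<bar>T\<bar> + 1} x'" using x'_lip[of "\<bar>T\<bar> + 1"] by force
    then have L: "L-lipschitz_on {1..T} x'" by (rule lipschitz_on_subset) auto
    obtain M where M: "M-lipschitz_on {1..T} x"
      using C1_imp_lipschitz_on_interval[of 1 T x x'] x_deriv lipschitz_on_continuous_on[OF L] by force
    have "bounded (x ` {1..T})"
      using lipschitz_on_continuous_on[OF M] by (intro compact_imp_bounded compact_continuous_image) auto
    then obtain K where "K-lipschitz_on (x ` {1..T}) gradf" using assms(7) by blast
    from lipschitz_on_add[OF L lipschitz_on_cmult[OF lipschitz_on_compose2[OF M this]]]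
    show "\<exists>L. L-lipschitz_on {1..T} u" unfolding u_def by blast
  next
    fix t :: real assume "1 < t" "t \<notin> N"
    then obtain p where x'': "(x' has_vector_derivative x'' t) (at t)"
      and p: "p \<in> subdifferential \<phi> (u t)"
      and eq: "x'' t + p + \<beta> *\<^sub>R blinfun_apply (hessf (x t)) (x' t) + gradf (x t) = 0"
      using NP[of t] unfolding P_def u_def by auto
    define u' where "u' = x'' t + \<beta> *\<^sub>R blinfun_apply (hessf (x t)) (x' t)"
    have "(gradf \<circ> x has_vector_derivative blinfun_apply (hessf (x t)) (x' t)) (at t)"
      using vector_derivative_diff_chain_within[OF x_deriv has_derivative_at_withinI[OF assms(4)]]
        \<open>1 < t\<close> by simp
    from has_vector_derivative_add[OF x'' has_vector_derivative_scaleR[OF DERIV_const this, of \<beta>]]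
    have "(u has_vector_derivative u') (at t)" by (simp add: u_def[abs_def] u'_def o_def)
    moreover have "u' \<bullet> u t + gradf (x t) \<bullet> u t = - (p \<bullet> u t)"
    proof -
      have "u' + gradf (x t) = - p" using eq unfolding u'_def by (simp add: eq_neg_iff_add_eq_0 ac_simps)
      then show ?thesis by (metis inner_add_left inner_minus_left)
    qed
    moreover have "r * norm (u t) \<le> p \<bullet> u t"
      using subgradient_inner_ge[OF p] assms(8) assms(10)[of "u t"] unfolding damping_potential_def by simp
    ultimately show "\<exists>u'. (u has_vector_derivative u') (at t) \<and>
        u' \<bullet> u t + gradf (x t) \<bullet> u t \<le> - r * norm (u t)" by auto
  qed (use assms z N in auto)
  obtain T where "1 \<le> T" "\<forall>t\<ge>T. u t = 0" using finite_time_extinction by blast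
  then show ?thesis unfolding u_def by (intro exI[of _ T]) auto
qed

end
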